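(* Under the standing assumptions in the context, let $\beta\in[1-1/\sqrt2,1)$, $\gamma\in(0,1)$ and $0<\lambda\le(1-\beta)\tau\Big(\frac{\beta\mu}{\rho G_h}\Big)^{1/\nu}$. Set $q:=\sqrt{1-\gamma(1-\beta)^2\tau^2}$. Let $(x_k)_{k\ge0}$ be generated by PSGA with step-size $\alpha_k=\lambda q^k$ and an initial point $x_0\in\mathcal{T}_\beta$ satisfying $$\operatorname{dist}(x_0;\mathcal{X}^* )\le\frac{\lambda}{\tau(1-\beta)-\sqrt{\tau^2(1-\beta)^2-(1-q^2)}},$$ and set $A:=\max\Big\{\frac{\lambda}{(1-\beta)\tau},\operatorname{dist}(x_0;\mathcal{X}^* )\Big\}$. Then $(x_k)$ converges and, denoting its limit by $x^*$, for all $k\ge0$ $$\operatorname{dist}(x_k;\mathcal{X}^* )\le Aq^k,\qquad f(x_k)-f^*\le LAq^k,\qquad\|x_k-x^*\|\le\frac{\lambda q^k}{1-q}.$$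
   Context: Notation: $\|\cdot\|$ is the Euclidean norm on $\mathbb{R}^n$, $\operatorname{dist}(x;S)=\inf_{z\in S}\|z-x\|$, $\operatorname{proj}_S(x)=\operatorname{argmin}_{z\in S}\|z-x\|$ (a set in general). $\partial f(x)$ is the Fréchet subdifferential: all $\zeta$ with $f(y)\ge f(x)+\langle\zeta,y-x\rangle+o(\|y-x\|)$ as $y\to x$. Standing assumptions: $h:\mathbb{R}^n\to\mathbb{R}\cup\{+\infty\}$ is a Legendre kernel: proper, lower semicontinuous, strictly convex, continuously differentiable on $\operatorname{int}\operatorname{dom}(h)\ne\emptyset$, and essentially smooth ($\|\nabla h(x_k)\|\to\infty$ whenever $x_k\in\operatorname{int}\operatorname{dom}(h)$ converges to a boundary point of $\operatorname{dom}(h)$). $D_h(x,y)=h(x)-h(y)-\langle\nabla h(y),x-y\rangle$ for $y\in\operatorname{int}\operatorname{dom}(h)$. $X\subseteq\operatorname{int}\operatorname{dom}(h)$ is nonempty, closed and convex. $f:\mathbb{R}^n\to\mathbb{R}\cup\{+\infty\}$ is proper (not assumed differentiable), $\rho>0$, and $f+\rho h$ is convex on $\operatorname{int}\operatorname{dom}(h)$ ($f$ is $\rho$-weakly convex relative to $h$); $f$ is finite and locally Lipschitz around every point of $X$. $f^*:=\inf_Xf>-\infty$ and $\mathcal{X}^*:=\{x\in X:f(x)=f^*\}\neq\emptyset$; moreover $\mathcal{X}^*\ne X$. Sharpness: $\mu>0$ and $\mu\operatorname{dist}(x;\mathcal{X}^* )\le f(x)-f^*$ for all $x\in X$. Local Bregman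 growth: $\nu\in(0,1]$, $G_h>0$ and $\inf_{y\in\operatorname{proj}_{\mathcal{X}^*}(x)}D_h(y,x)\le G_h\operatorname{dist}^{1+\nu}(x;\mathcal{X}^* )$ for all $x\in X$ with $\operatorname{dist}(x;\mathcal{X}^* )<(\mu/(\rho G_h))^{1/\nu}$. For $\beta\in(0,1]$, $\mathcal{T}_\beta:=\{x\in X:\operatorname{dist}(x;\mathcal{X}^* )<(\beta\mu/(\rho G_h))^{1/\nu}\}$. $L:=\sup\{\|\zeta\|:\zeta\in\partial f(x),\,x\in\mathcal{T}_1\}$, assumed to satisfy $0<L<\infty$, and $\tau:=\mu/L$. PSGA (projected subgradient algorithm): given $\beta\in(0,1)$, $x_0\in\mathcal{T}_\beta$ and step-sizes $\alpha_k>0$, for $k=0,1,2,\dots$ choose any $\zeta_k\in\partial f(x_k)$ and set $x_{k+1}=\operatorname{proj}_X\big(x_k-\alpha_k\zeta_k/\|\zeta_k\|\big)$ (with $x_{k+1}=x_k$ if $\zeta_k=0$). *)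

theory Defs
  imports "HOL-Analysis.Analysis" "HOL-Library.Landau_Symbols"
begin

definition eff_dom :: "('a \<Rightarrow> ereal) \<Rightarrow> 'a set" where
  "eff_dom F = {x. F x < \<infinity>}"

definition proper_ereal :: "('a \<Rightarrow> ereal) \<Rightarrow> bool" where
  "proper_ereal F \<longleftrightarrow> (\<forall>x. F x \<noteq> -\<infinity>) \<and> eff_dom F \<noteq> {}"

definition lsc_ereal :: "('a::topological_space \<Rightarrow> ereal) \<Rightarrow> bool" where
  "lsc_ereal F \<longleftrightarrow> (\<forall>x. F x \<le> Liminf (at x) F)"

text \<open>The next definition is meant for functions that do not take the value \<open>-\<infinity>\<close>; then no sum
  \<open>\<infinity> - \<infinity>\<close> occurs, and the convention \<open>0 * \<infinity> = 0\<close> makes \<open>u = 0\<close> and \<open>v = 0\<close> harmless.\<close>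

definition convex_on_ereal :: "'a::real_vector set \<Rightarrow> ('a \<Rightarrow> ereal) \<Rightarrow> bool" where
  "convex_on_ereal S F \<longleftrightarrow> convex S \<and>
    (\<forall>x\<in>S. \<forall>y\<in>S. \<forall>u\<ge>0. \<forall>v\<ge>0. u + v = 1 \<longrightarrow>
       F (u *\<^sub>R x + v *\<^sub>R y) \<le> ereal u * F x + ereal v * F y)"

definition strictly_convex_ereal :: "('a::real_vector \<Rightarrow> ereal) \<Rightarrow> bool" where
  "strictly_convex_ereal F \<longleftrightarrow>
    (\<forall>x\<in>eff_dom F. \<forall>y\<in>eff_dom F. \<forall>u>0. \<forall>v>0. x \<noteq> y \<and> u + v = 1 \<longrightarrow>
       F (u *\<^sub>R x + v *\<^sub>R y) < ereal u * F x + ereal v * F y)"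

text \<open>The gradient is meaningful at points of \<open>interior (eff_dom F)\<close> where \<open>F\<close> is differentiable;
  near such points a function without the value \<open>-\<infinity>\<close> is finite, so \<open>real_of_ereal\<close> loses nothing.\<close>

definition grad :: "('a::real_inner \<Rightarrow> ereal) \<Rightarrow> 'a \<Rightarrow> 'a" where
  "grad F x = (THE D. GDERIV (\<lambda>y. real_of_ereal (F y)) x :> D)"

definition C1_on_interior :: "('a::real_inner \<Rightarrow> ereal) \<Rightarrow> bool" where
  "C1_on_interior F \<longleftrightarrow>
    (\<forall>x\<in>interior (eff_dom F). \<exists>D. GDERIV (\<lambda>y. real_of_ereal (F y)) x :> D) \<and>
    continuous_on (interior (eff_dom F)) (grad F)"

definition essentially_smooth :: "('a::real_inner \<Rightarrow> ereal) \<Rightarrow> bool" where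
  "essentially_smooth F \<longleftrightarrow>
    (\<forall>x z. (\<forall>k::nat. x k \<in> interior (eff_dom F)) \<and> x \<longlonglongrightarrow> z \<and> z \<in> frontier (eff_dom F) \<longrightarrow>
       filterlim (\<lambda>k. norm (grad F (x k))) at_top sequentially)"

definition legendre_kernel :: "('a::real_inner \<Rightarrow> ereal) \<Rightarrow> bool" where
  "legendre_kernel h \<longleftrightarrow> proper_ereal h \<and> lsc_ereal h \<and> strictly_convex_ereal h \<and>
     interior (eff_dom h) \<noteq> {} \<and> C1_on_interior h \<and> essentially_smooth h"

definition bregman :: "('a::real_inner \<Rightarrow> ereal) \<Rightarrow> 'a \<Rightarrow> 'a \<Rightarrow> ereal" where
  "bregman h x y = h x - h y - ereal (grad h y \<bullet> (x - y))"

definition proj_set :: "'a::real_normed_vector set \<Rightarrow> 'a \<Rightarrow> 'a set" where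
  "proj_set S x = {z. is_arg_min (\<lambda>w. norm (w - x)) (\<lambda>w. w \<in> S) z}"

text \<open>Empty, by convention, at points where \<open>F\<close> is not finite.\<close>

definition frechet_subdiff :: "('a::real_inner \<Rightarrow> ereal) \<Rightarrow> 'a \<Rightarrow> 'a set" where
  "frechet_subdiff F x = {\<zeta>. \<bar>F x\<bar> \<noteq> \<infinity> \<and>
     (\<exists>r \<in> o[at x](\<lambda>y. norm (y - x)). \<forall>\<^sub>F y in at x. F y \<ge> F x + ereal (\<zeta> \<bullet> (y - x)) + ereal (r y))}"

definition finite_locally_lipschitz_at :: "('a::metric_space \<Rightarrow> ereal) \<Rightarrow> 'a \<Rightarrow> bool" where
  "finite_locally_lipschitz_at F x \<longleftrightarrow>
    (\<exists>r>0. \<exists>C. (\<forall>y\<in>ball x r. \<bar>F y\<bar> \<noteq> \<infinity>) \<and> C-lipschitz_on (ball x r) (\<lambda>y. real_of_ereal (F y)))"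

definition opt_value :: "('a \<Rightarrow> ereal) \<Rightarrow> 'a set \<Rightarrow> ereal" where
  "opt_value f X = (INF x\<in>X. f x)"

definition opt_set :: "('a \<Rightarrow> ereal) \<Rightarrow> 'a set \<Rightarrow> 'a set" where
  "opt_set f X = {x\<in>X. f x = opt_value f X}"

definition tube ::
  "('a::metric_space \<Rightarrow> ereal) \<Rightarrow> 'a set \<Rightarrow> real \<Rightarrow> real \<Rightarrow> real \<Rightarrow> real \<Rightarrow> real \<Rightarrow> 'a set" where
  "tube f X \<mu> \<rho> G \<nu> \<beta> = {x\<in>X. infdist x (opt_set f X) < (\<beta> * \<mu> / (\<rho> * G)) powr (1 / \<nu>)}"

definition psga_sequence ::
  "('a::real_inner \<Rightarrow> ereal) \<Rightarrow> 'a set \<Rightarrow> (nat \<Rightarrow> real) \<Rightarrow> (nat \<Rightarrow> 'a) \<Rightarrow> bool" where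
  "psga_sequence f X \<alpha> x \<longleftrightarrow>
    (\<exists>\<zeta>. \<forall>k. \<zeta> k \<in> frechet_subdiff f (x k) \<and>
       (if \<zeta> k = 0 then x (Suc k) = x k
        else x (Suc k) \<in> proj_set X (x k - (\<alpha> k / norm (\<zeta> k)) *\<^sub>R \<zeta> k)))"

end

(* A Frechet subgradient z of f at y, plus rho * grad h y, is a subgradient of the convex function
   f + rho h, so f w >= f y + <z, w - y> - rho * D_h(w, y).  At a projection w of y onto the
   solution set, sharpness and the growth bound on D_h turn this into
   <z, y - w> >= (1 - beta) * mu * d with d = dist(y; argmin f), and a projected step of length a gives
   d'^2 <= d^2 - 2 c a d + a^2 with c = (1 - beta) * tau.  For a = lam * q^k this recursion preserves
   d <= A * q^k.  Since subgradients of norm at most L exist on the whole segment from y to its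
   projection, a Dini-derivative argument gives f y - min f <= L d; with sharpness this yields tau <= 1,
   which keeps q real and at least c. *)
theory Submission
  imports Defs
begin

section \<open>Subgradient inequality for relatively weakly convex functions\<close>

lemma grad_eq:
  assumes "GDERIV (\<lambda>y. real_of_ereal (F y)) x :> D"
  shows "grad F x = D"
  unfolding grad_def
proof (rule the_equality[where P = "\<lambda>D. GDERIV (\<lambda>y. real_of_ereal (F y)) x :> D", OF assms])
  fix E assume "GDERIV (\<lambda>y. real_of_ereal (F y)) x :> E"
  then have "(\<lambda>h. h \<bullet> E) = (\<lambda>h. h \<bullet> D)"
    using assms unfolding gderiv_def by (rule has_derivative_unique)
  then have "\<And>h. h \<bullet> (E - D) = 0"
    by (metis inner_diff_right right_minus_eq)
  from this[of "E - D"] show "E = D" by simp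
qed

text \<open>Every slack \<open>e\<close> below is removed through this limit from the right at 0;
  \<open>c\<close> may have any sign, so error coefficients need no sign check.\<close>

lemma le_of_le_add_small_mult:
  fixes a b c :: real
  assumes "\<And>e. e > 0 \<Longrightarrow> a \<le> b + e * c"
  shows "a \<le> b"
proof (rule tendsto_lowerbound)
  have "((\<lambda>e. b + e * c) \<longlongrightarrow> b + 0 * c) (at_right 0)"
    by (intro tendsto_intros)
  then show "((\<lambda>e. b + e * c) \<longlongrightarrow> b) (at_right 0)" by simp
  show "\<forall>\<^sub>F e in at_right 0. a \<le> b + e * c"
    using assms by (simp add: eventually_at_right_less eventually_mono[OF eventually_at_right_less])
qed simp

lemma frechet_subdiffE:
  assumes "\<zeta> \<in> frechet_subdiff F x"
  obtains r where "\<bar>F x\<bar> \<noteq> \<infinity>" "r \<in> o[at x](\<lambda>y. norm (y - x))"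
    "\<forall>\<^sub>F y in at x. F y \<ge> F x + ereal (\<zeta> \<bullet> (y - x)) + ereal (r y)"
  using assms unfolding frechet_subdiff_def mem_Collect_eq by (elim conjE bexE) (rule that)

text \<open>Along \<open>w t = x + t *\<^sub>R (y - x)\<close>, convexity of f + \<rho> h bounds the
  value at \<open>w t\<close> above by the chord. The Frechet inequality for f and differentiability
  of h at \<open>x\<close> bound it below up to an error of order \<open>e * t\<close>. Dividing by
  \<open>t\<close> and letting \<open>e\<close> tend to 0 leaves the claim; for each
  \<open>e\<close> a single small \<open>t\<close> suffices.\<close>

lemma frechet_subgradient_bregman_le:
  fixes f h :: "'a::real_inner \<Rightarrow> ereal"
  assumes conv: "convex_on_ereal U (\<lambda>y. f y + ereal \<rho> * h y)" and \<rho>: "\<rho> \<ge> 0"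
    and h: "\<And>y. y \<in> U \<Longrightarrow> \<bar>h y\<bar> \<noteq> \<infinity>" "GDERIV (\<lambda>y. real_of_ereal (h y)) x :> D"
    and xy: "x \<in> U" "y \<in> U" "\<bar>f y\<bar> \<noteq> \<infinity>"
    and \<zeta>: "\<zeta> \<in> frechet_subdiff f x"
  shows "real_of_ereal (f x) + \<zeta> \<bullet> (y - x)
      - \<rho> * (real_of_ereal (h y) - real_of_ereal (h x) - D \<bullet> (y - x)) \<le> real_of_ereal (f y)"
proof (cases "y = x")
  case False
  define F where "F y = real_of_ereal (f y)" for y
  define H where "H y = real_of_ereal (h y)" for y
  define w where "w t = x + t *\<^sub>R (y - x)" for t :: real
  obtain r where fx: "\<bar>f x\<bar> \<noteq> \<infinity>" and r: "r \<in> o[at x](\<lambda>y. norm (y - x))"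
    and sub: "\<forall>\<^sub>F y in at x. f y \<ge> f x + ereal (\<zeta> \<bullet> (y - x)) + ereal (r y)"
    using frechet_subdiffE[OF \<zeta>] by blast
  have w_lim: "filterlim w (at x) (at_right 0)"
  proof (rule filterlim_atI)
    have "(w \<longlongrightarrow> x + 0 *\<^sub>R (y - x)) (at_right 0)"
      unfolding w_def by (intro tendsto_intros)
    then show "(w \<longlongrightarrow> x) (at_right 0)" by simp
    show "\<forall>\<^sub>F t in at_right 0. w t \<noteq> x"
      using False by (auto simp: w_def intro: eventually_mono[OF eventually_at_right_less])
  qed
  have "F x + \<zeta> \<bullet> (y - x) - \<rho> * (H y - H x - D \<bullet> (y - x))
      \<le> F y + e * ((1 + \<rho>) * norm (y - x))" if e: "e > 0" for e
  proof -
    have "\<forall>\<^sub>F w in at x. \<bar>r w\<bar> \<le> e * norm (w - x)"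
      using landau_o.smallD[OF r e] by simp
    moreover have "\<forall>\<^sub>F w in at x. norm (H w - H x - (w - x) \<bullet> D) \<le> e * norm (w - x)"
      using h(2) e unfolding gderiv_def has_derivative_within_alt2 H_def by blast
    ultimately have "\<forall>\<^sub>F w in at x. \<bar>r w\<bar> \<le> e * norm (w - x) \<and>
        norm (H w - H x - (w - x) \<bullet> D) \<le> e * norm (w - x) \<and>
        f w \<ge> f x + ereal (\<zeta> \<bullet> (w - x)) + ereal (r w)"
      using sub by eventually_elim auto
    then have "\<forall>\<^sub>F t in at_right 0. \<bar>r (w t)\<bar> \<le> e * norm (w t - x) \<and>
        norm (H (w t) - H x - (w t - x) \<bullet> D) \<le> e * norm (w t - x) \<and>
        f (w t) \<ge> f x + ereal (\<zeta> \<bullet> (w t - x)) + ereal (r (w t))"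
      using w_lim by (rule eventually_compose_filterlim)
    moreover have "\<forall>\<^sub>F t in at_right 0. t \<in> {0<..<1::real}"
      by (rule eventually_at_right_real) simp
    ultimately have "\<forall>\<^sub>F t in at_right 0. t \<in> {0<..<1::real} \<and> \<bar>r (w t)\<bar> \<le> e * norm (w t - x) \<and>
        norm (H (w t) - H x - (w t - x) \<bullet> D) \<le> e * norm (w t - x) \<and>
        f (w t) \<ge> f x + ereal (\<zeta> \<bullet> (w t - x)) + ereal (r (w t))"
      by eventually_elim auto
    then obtain t where t: "0 < t" "t < 1" "\<bar>r (w t)\<bar> \<le> e * norm (w t - x)"
        "norm (H (w t) - H x - (w t - x) \<bullet> D) \<le> e * norm (w t - x)"
        "f (w t) \<ge> f x + ereal (\<zeta> \<bullet> (w t - x)) + ereal (r (w t))"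
      using eventually_happens[of _ "at_right (0::real)"] by (auto simp: trivial_limit_at_right_real)
    have wt: "w t = (1 - t) *\<^sub>R x + t *\<^sub>R y"
      by (simp add: w_def algebra_simps)
    have "w t \<in> U"
      using conv t(1,2) xy unfolding convex_on_ereal_def wt by (intro convexD) auto
    then have hw: "h (w t) = ereal (H (w t))"
      using h(1) by (simp add: H_def ereal_real)
    have hxy: "h x = ereal (H x)" "h y = ereal (H y)" "f x = ereal (F x)" "f y = ereal (F y)"
      using h(1) xy fx by (simp_all add: H_def F_def ereal_real)
    have "f (w t) + ereal \<rho> * h (w t)
        \<le> ereal (1 - t) * (f x + ereal \<rho> * h x) + ereal t * (f y + ereal \<rho> * h y)"
      using conv t(1,2) xy unfolding convex_on_ereal_def wt by auto
    then have "f (w t) + ereal (\<rho> * H (w t))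
        \<le> ereal ((1 - t) * (F x + \<rho> * H x) + t * (F y + \<rho> * H y))"
      by (simp add: hw hxy)
    \<comment> \<open>Finiteness of \<open>f (w t)\<close> is not assumed: the upper bound excludes
      one infinite value and this lower bound the other, which justifies the passage to
      reals.\<close>
    moreover have "ereal (F x + \<zeta> \<bullet> (w t - x) + r (w t)) \<le> f (w t)"
      using t(5) by (simp add: hxy)
    ultimately have "F x + \<zeta> \<bullet> (w t - x) + r (w t) + \<rho> * H (w t)
        \<le> (1 - t) * (F x + \<rho> * H x) + t * (F y + \<rho> * H y)"
      by (cases "f (w t)") auto
    moreover have wx: "w t - x = t *\<^sub>R (y - x)" by (simp add: w_def)
    moreover have "- (e * (t * norm (y - x))) \<le> r (w t)"
      using t(1,3) by (simp add: wx abs_le_iff)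
    moreover have "\<rho> * (H x + t * (D \<bullet> (y - x)) - e * (t * norm (y - x))) \<le> \<rho> * H (w t)"
      using t(1,4) by (intro mult_left_mono \<rho>) (simp add: wx abs_le_iff inner_commute)
    ultimately have "t * (F x + \<zeta> \<bullet> (y - x) - \<rho> * (H y - H x - D \<bullet> (y - x)))
        \<le> t * (F y + e * ((1 + \<rho>) * norm (y - x)))"
      by (simp add: algebra_simps)
    then show ?thesis using t(1) by simp
  qed
  from le_of_le_add_small_mult[OF this] show ?thesis by (simp add: F_def H_def)
qed simp

section \<open>Existence of Frechet subgradients\<close>

text \<open>A hyperplane separates the point \<open>(z, g z)\<close> from the strict epigraph of
  \<open>g\<close>. Since \<open>S\<close> is open, the hyperplane cannot be vertical, and its slope
  is the subgradient.\<close>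

lemma convex_subgradient_exists:
  fixes g :: "'a::euclidean_space \<Rightarrow> real"
  assumes g: "convex_on S g" and S: "open S" "z \<in> S"
  obtains p where "\<And>w. w \<in> S \<Longrightarrow> g z + p \<bullet> (w - z) \<le> g w"
proof -
  define E where "E = {wt. fst wt \<in> S \<and> g (fst wt) < snd wt}"
  have "convex E"
  proof (rule convexI)
    fix a b and u v :: real assume ab: "a \<in> E" "b \<in> E" and uv: "0 \<le> u" "0 \<le> v" "u + v = 1"
    have "u *\<^sub>R fst a + v *\<^sub>R fst b \<in> S"
      using ab uv convex_on_imp_convex[OF g] by (auto simp: E_def intro: convexD)
    moreover have "g (u *\<^sub>R fst a + v *\<^sub>R fst b) \<le> u * g (fst a) + v * g (fst b)"
      using g ab uv unfolding convex_on_def E_def by blast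
    \<comment> \<open>Strictness comes from a point with positive weight, hence the split on
      \<open>u = 0\<close>.\<close>
    moreover have "u * g (fst a) + v * g (fst b) < u * snd a + v * snd b"
    proof (cases "u = 0")
      case True then show ?thesis using ab uv by (auto simp: E_def)
    next
      case False
      then have "u * g (fst a) < u * snd a" using ab uv by (simp add: E_def)
      moreover have "v * g (fst b) \<le> v * snd b"
        using ab uv by (intro mult_left_mono) (auto simp: E_def)
      ultimately show ?thesis by simp
    qed
    ultimately show "u *\<^sub>R a + v *\<^sub>R b \<in> E" by (simp add: E_def)
  qed
  moreover have "(z, g z + 1) \<in> E" using S by (simp add: E_def)
  moreover have "{(z, g z)} \<inter> E = {}" by (simp add: E_def)
  ultimately obtain a b where "a \<noteq> 0" and ab: "\<forall>x\<in>{(z, g z)}. a \<bullet> x \<le> b" "\<forall>x\<in>E. a \<bullet> x \<ge> b"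
    using separating_hyperplane_sets[of "{(z, g z)}" E] by blast
  obtain p s where a: "a = (p, s)" by (cases a)
  have sep: "p \<bullet> z + s * g z \<le> p \<bullet> w + s * t" if "w \<in> S" "g w < t" for w t
  proof -
    have "(w, t) \<in> E" using that by (simp add: E_def)
    then show ?thesis using ab by (fastforce simp: a)
  qed
  have "s \<ge> 0" using sep[of z "g z + 1"] S by (simp add: algebra_simps)
  moreover have "s \<noteq> 0"
  proof
    \<comment> \<open>For a vertical hyperplane, moving from \<open>z\<close> a short way against
      \<open>p\<close> stays inside \<open>S\<close> and violates the separation unless
      \<open>p = 0\<close>. The \<open>+ 1\<close> in the denominator of \<open>d\<close> covers
      \<open>p = 0\<close>.\<close>
    assume s: "s = 0"
    obtain e where e: "e > 0" "ball z e \<subseteq> S" using S open_contains_ball by blast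
    define d where "d = e / (2 * (norm p + 1))"
    have np: "norm p + 1 > 0" by (simp add: add_nonneg_pos)
    have d: "d > 0" using e np by (simp add: d_def)
    have "d * norm p < e"
      using e np by (simp add: d_def field_simps) (smt (verit) mult_nonneg_nonneg norm_ge_zero)
    then have "z - d *\<^sub>R p \<in> S" using e(2) d by (auto simp: dist_norm)
    from sep[OF this, of "g (z - d *\<^sub>R p) + 1"] have "d * (p \<bullet> p) \<le> 0"
      by (simp add: s inner_diff_right)
    then have "p \<bullet> p \<le> 0" using d by (simp add: mult_le_0_iff)
    then have "p = 0" by (metis inner_eq_zero_iff inner_ge_zero order_antisym)
    then show False using \<open>a \<noteq> 0\<close> a s by (simp add: zero_prod_def)
  qed
  ultimately have s: "s > 0" by simp
  show thesis
  proof
    fix w assume w: "w \<in> S"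
    have "p \<bullet> z + s * g z \<le> p \<bullet> w + s * g w"
    proof (rule le_of_le_add_small_mult)
      fix e :: real assume "e > 0"
      then show "p \<bullet> z + s * g z \<le> p \<bullet> w + s * g w + e * s"
        using sep[OF w, of "g w + e"] by (simp add: algebra_simps)
    qed
    then have "s * (g z + (- (1 / s) *\<^sub>R p) \<bullet> (w - z)) \<le> s * g w"
      using s by (simp add: algebra_simps inner_diff_right)
    then show "g z + (- (1 / s) *\<^sub>R p) \<bullet> (w - z) \<le> g w" using s by simp
  qed
qed

text \<open>On a small ball around \<open>x\<close> inside \<open>U\<close> both functions are
  finite, so f + \<rho> h is a real convex function there and has a subgradient \<open>p\<close>.
  Removing the smooth part \<rho> h leaves \<open>p - \<rho> *\<^sub>R D\<close> for f.\<close>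

lemma frechet_subdiff_nonempty:
  fixes f h :: "'a::euclidean_space \<Rightarrow> ereal"
  assumes conv: "convex_on_ereal U (\<lambda>y. f y + ereal \<rho> * h y)" and U: "open U" "x \<in> U"
    and h: "\<And>y. y \<in> U \<Longrightarrow> \<bar>h y\<bar> \<noteq> \<infinity>" "GDERIV (\<lambda>y. real_of_ereal (h y)) x :> D"
    and f: "finite_locally_lipschitz_at f x"
  shows "frechet_subdiff f x \<noteq> {}"
proof -
  define F where "F y = real_of_ereal (f y)" for y
  define H where "H y = real_of_ereal (h y)" for y
  obtain e where e: "e > 0" "\<And>y. y \<in> ball x e \<Longrightarrow> \<bar>f y\<bar> \<noteq> \<infinity>"
    using f unfolding finite_locally_lipschitz_at_def by meson
  define S where "S = U \<inter> ball x e"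
  have S: "open S" "x \<in> S" using U e by (auto simp: S_def)
  have fin: "f y = ereal (F y)" "h y = ereal (H y)" if "y \<in> S" for y
    using that e h(1) by (simp_all add: S_def F_def H_def ereal_real)
  have convS: "convex S" using conv by (auto simp: S_def convex_on_ereal_def intro: convex_Int)
  have "convex_on S (\<lambda>y. F y + \<rho> * H y)"
    unfolding convex_on_def
  proof (intro conjI convS ballI allI impI)
    fix a b and u v :: real assume ab: "a \<in> S" "b \<in> S" and uv: "0 \<le> u" "0 \<le> v" "u + v = 1"
    define w where "w = u *\<^sub>R a + v *\<^sub>R b"
    have w: "w \<in> S" using convS ab uv unfolding w_def by (rule convexD)
    have "f w + ereal \<rho> * h w \<le> ereal u * (f a + ereal \<rho> * h a) + ereal v * (f b + ereal \<rho> * h b)"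
      using conv ab uv unfolding convex_on_ereal_def w_def S_def by blast
    then show "F (u *\<^sub>R a + v *\<^sub>R b) + \<rho> * H (u *\<^sub>R a + v *\<^sub>R b)
        \<le> u * (F a + \<rho> * H a) + v * (F b + \<rho> * H b)"
      using fin[OF w] fin[OF ab(1)] fin[OF ab(2)] by (simp add: w_def)
  qed
  from convex_subgradient_exists[OF this S] obtain p
    where p: "\<And>w. w \<in> S \<Longrightarrow> F x + \<rho> * H x + p \<bullet> (w - x) \<le> F w + \<rho> * H w" by blast
  \<comment> \<open>This is -\<rho> times the first-order Taylor error of h; with it the inequality
    for \<open>p\<close> becomes the Frechet inequality verbatim.\<close>
  define r where "r w = - \<rho> * (H w - H x - D \<bullet> (w - x))" for w
  have "(\<lambda>w. H w - H x - D \<bullet> (w - x)) \<in> o[at x](\<lambda>w. norm (w - x))"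
  proof (rule landau_o.smallI)
    fix c :: real assume "c > 0"
    then show "\<forall>\<^sub>F w in at x. norm (H w - H x - D \<bullet> (w - x)) \<le> c * norm (norm (w - x))"
      using h(2) unfolding gderiv_def has_derivative_within_alt2 H_def by (simp add: inner_commute)
  qed
  then have r: "r \<in> o[at x](\<lambda>w. norm (w - x))"
    unfolding r_def by (cases "\<rho> = 0") auto
  have "\<forall>\<^sub>F w in at x. w \<in> S" using S by (rule eventually_at_in_open')
  then have "\<forall>\<^sub>F w in at x. f w \<ge> f x + ereal ((p - \<rho> *\<^sub>R D) \<bullet> (w - x)) + ereal (r w)"
  proof eventually_elim
    case (elim w)
    then show ?case using p[OF elim] fin S by (simp add: r_def algebra_simps inner_diff_left inner_diff_right)
  qed
  then have "p - \<rho> *\<^sub>R D \<in> frechet_subdiff f x"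
    using r fin[OF S(2)] unfolding frechet_subdiff_def by auto
  then show ?thesis by blast
qed

section \<open>Lipschitz-type bounds from bounded subgradients\<close>

text \<open>The points where the bound with slope \<open>M + e\<close> holds form a compact set
  containing \<open>a\<close>. If its maximum were below \<open>b\<close>, the one-sided hypothesis
  there would produce a larger point of the set.\<close>

lemma dini_mean_value:
  fixes g :: "real \<Rightarrow> real"
  assumes ab: "a \<le> b" and cont: "continuous_on {a..b} g"
    and dini: "\<And>t e. a \<le> t \<Longrightarrow> t < b \<Longrightarrow> e > 0 \<Longrightarrow>
      \<forall>\<^sub>F s in at_right t. g t - (M + e) * (s - t) \<le> g s"
  shows "g a - M * (b - a) \<le> g b"
proof (rule le_of_le_add_small_mult)
  fix e :: real assume e: "e > 0"
  define S where "S = {s \<in> {a..b}. g a - (M + e) * (s - a) \<le> g s}"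
  have "closed S" unfolding S_def
    by (intro continuous_on_closed_Collect_le continuous_intros cont)
  moreover have "S \<subseteq> {a..b}" by (auto simp: S_def)
  ultimately have "compact S" by (meson bounded_closed_interval bounded_subset compact_eq_bounded_closed)
  moreover have "a \<in> S" using ab by (simp add: S_def)
  ultimately obtain t where t: "t \<in> S" "\<And>s. s \<in> S \<Longrightarrow> s \<le> t"
    using compact_attains_sup[of S] by auto
  have "t = b"
  proof (rule ccontr)
    assume "t \<noteq> b"
    then have tb: "a \<le> t" "t < b" using t by (auto simp: S_def)
    have "\<forall>\<^sub>F s in at_right t. s \<in> {t<..<b}" using tb by (intro eventually_at_right_real)
    with dini[OF tb e] have "\<forall>\<^sub>F s in at_right t. g t - (M + e) * (s - t) \<le> g s \<and> s \<in> {t<..<b}"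
      by eventually_elim auto
    then obtain s where s: "g t - (M + e) * (s - t) \<le> g s" "t < s" "s < b"
      using eventually_happens[of _ "at_right t"] by (auto simp: trivial_limit_at_right_real)
    then have "s \<in> S" using t(1) tb by (simp add: S_def algebra_simps)
    then show False using t(2) s by force
  qed
  then show "g a - M * (b - a) \<le> g b + e * (b - a)" using t(1) by (simp add: S_def algebra_simps)
qed

text \<open>A subgradient of norm at most \<open>L\<close> at a point of the segment bounds the
  right lower Dini derivative of f along the segment from below by
  \<open>- L * norm (y - x)\<close>. Local Lipschitz continuity supplies the continuity and
  finiteness needed to integrate this bound.\<close>

lemma le_add_norm_of_frechet_subgradient_bound:
  fixes f :: "'a::real_inner \<Rightarrow> ereal"
  assumes lip: "\<And>z. z \<in> closed_segment x y \<Longrightarrow> finite_locally_lipschitz_at f z"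
    and sub: "\<And>z. z \<in> closed_segment x y \<Longrightarrow> \<exists>\<zeta>\<in>frechet_subdiff f z. norm \<zeta> \<le> L"
  shows "real_of_ereal (f x) - L * norm (x - y) \<le> real_of_ereal (f y)"
proof (cases "x = y")
  case False
  define F where "F y = real_of_ereal (f y)" for y
  define w where "w t = x + t *\<^sub>R (y - x)" for t :: real
  have seg: "w t \<in> closed_segment x y" if "0 \<le> t" "t \<le> 1" for t
    unfolding closed_segment_def using that by (auto simp: w_def algebra_simps intro!: exI[of _ t])
  have fin: "f z = ereal (F z)" if "z \<in> closed_segment x y" for z
    using lip[OF that] unfolding finite_locally_lipschitz_at_def by (metis F_def centre_in_ball ereal_real)
  have F_cont: "isCont F z" if z: "z \<in> closed_segment x y" for z
  proof -
    obtain r C where "r > 0" "C-lipschitz_on (ball z r) F"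
      using lip[OF z] unfolding finite_locally_lipschitz_at_def F_def by blast
    then have "continuous_on (ball z r) F" by (simp add: lipschitz_on_continuous_on)
    then show ?thesis using \<open>r > 0\<close> by (simp add: continuous_on_eq_continuous_at)
  qed
  have "(F \<circ> w) 0 - (L * norm (y - x)) * (1 - 0) \<le> (F \<circ> w) 1"
  proof (rule dini_mean_value)
    show "continuous_on {0..1} (F \<circ> w)"
    proof (rule continuous_on_compose)
      show "continuous_on {0..1} w" unfolding w_def by (intro continuous_intros)
      show "continuous_on (w ` {0..1}) F"
        using seg F_cont by (intro continuous_at_imp_continuous_on) auto
    qed
    fix t e :: real assume t: "0 \<le> t" "t < 1" and e: "e > 0"
    have wt: "w t \<in> closed_segment x y" using seg t by simp
    obtain \<zeta> where \<zeta>: "\<zeta> \<in> frechet_subdiff f (w t)" "norm \<zeta> \<le> L" using sub[OF wt] by blast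
    obtain r where r: "r \<in> o[at (w t)](\<lambda>y. norm (y - w t))"
      and ev: "\<forall>\<^sub>F v in at (w t). f v \<ge> f (w t) + ereal (\<zeta> \<bullet> (v - w t)) + ereal (r v)"
      using frechet_subdiffE[OF \<zeta>(1)] by blast
    have ny: "norm (y - x) > 0" using False by simp
    \<comment> \<open>The tolerance is divided by the speed \<open>norm (y - x)\<close> of
      \<open>w\<close>, so that the error becomes \<open>e * (s - t)\<close>.\<close>
    have "\<forall>\<^sub>F v in at (w t). \<bar>r v\<bar> \<le> e / norm (y - x) * norm (v - w t)"
      using landau_o.smallD[OF r, of "e / norm (y - x)"] e ny by simp
    with ev have "\<forall>\<^sub>F v in at (w t). f v \<ge> f (w t) + ereal (\<zeta> \<bullet> (v - w t)) + ereal (r v)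
        \<and> \<bar>r v\<bar> \<le> e / norm (y - x) * norm (v - w t)"
      by eventually_elim auto
    moreover have "filterlim w (at (w t)) (at_right t)"
    proof (rule filterlim_atI)
      show "(w \<longlongrightarrow> w t) (at_right t)"
        unfolding w_def by (intro tendsto_intros)
      show "\<forall>\<^sub>F s in at_right t. w s \<noteq> w t"
        using False by (auto simp: w_def intro: eventually_mono[OF eventually_at_right_less])
    qed
    ultimately have "\<forall>\<^sub>F s in at_right t. f (w s) \<ge> f (w t) + ereal (\<zeta> \<bullet> (w s - w t)) + ereal (r (w s))
        \<and> \<bar>r (w s)\<bar> \<le> e / norm (y - x) * norm (w s - w t)"
      by (rule eventually_compose_filterlim)
    moreover have "\<forall>\<^sub>F s in at_right t. s \<in> {t<..<1}" using t by (intro eventually_at_right_real)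
    ultimately show "\<forall>\<^sub>F s in at_right t.
        (F \<circ> w) t - (L * norm (y - x) + e) * (s - t) \<le> (F \<circ> w) s"
    proof eventually_elim
      case (elim s)
      have d: "w s - w t = (s - t) *\<^sub>R (y - x)" by (simp add: w_def algebra_simps)
      have nd: "norm (w s - w t) = (s - t) * norm (y - x)" using elim by (simp add: d)
      have "F (w t) + \<zeta> \<bullet> (w s - w t) + r (w s) \<le> F (w s)"
        using elim fin[OF wt] fin[OF seg[of s]] t by simp
      moreover have "\<bar>\<zeta> \<bullet> (w s - w t)\<bar> \<le> L * ((s - t) * norm (y - x))"
        using order_trans[OF Cauchy_Schwarz_ineq2 mult_right_mono[OF \<zeta>(2) norm_ge_zero]] nd by metis
      moreover have "\<bar>r (w s)\<bar> \<le> e * (s - t)"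
        using elim ny by (simp add: nd)
      ultimately show ?case by (simp add: algebra_simps abs_le_iff)
    qed
  qed simp
  then show ?thesis by (simp add: F_def w_def norm_minus_commute)
qed simp

section \<open>Projections and the projected step\<close>

lemma proj_set_iff: "z \<in> proj_set S x \<longleftrightarrow> z \<in> S \<and> (\<forall>w\<in>S. norm (z - x) \<le> norm (w - x))"
  by (auto simp: proj_set_def is_arg_min_linorder)

lemma norm_proj_set:
  assumes "z \<in> proj_set S x"
  shows "norm (z - x) = infdist x S"
proof (rule antisym)
  have "S \<noteq> {}" using assms by (auto simp: proj_set_iff)
  then show "norm (z - x) \<le> infdist x S" using assms
    by (auto simp: infdist_def proj_set_iff dist_norm norm_minus_commute intro: cINF_greatest)
  show "infdist x S \<le> norm (z - x)" using infdist_le[of z S x] assms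
    by (simp add: proj_set_iff dist_norm norm_minus_commute)
qed

text \<open>Expanding the squared distance from \<open>v\<close> to \<open>y\<close> around
  \<open>z\<close>, the cross term has a favourable sign by the variational inequality of the
  projection.\<close>

lemma proj_set_dist_le:
  fixes X :: "'a::euclidean_space set"
  assumes X: "closed X" "convex X" and z: "z \<in> proj_set X v" and y: "y \<in> X"
  shows "norm (z - y) \<le> norm (v - y)"
proof -
  have "(v - z) \<bullet> (y - z) \<le> 0"
    using z y by (intro any_closest_point_dot[OF X(2,1)])
      (auto simp: proj_set_iff dist_norm norm_minus_commute)
  moreover have "(norm (v - y))\<^sup>2 = (norm (v - z))\<^sup>2 + (norm (z - y))\<^sup>2 - 2 * ((v - z) \<bullet> (y - z))"
    by (simp add: power2_norm_eq_inner inner_diff_left inner_diff_right inner_commute)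
  ultimately have "(norm (z - y))\<^sup>2 \<le> (norm (v - y))\<^sup>2"
    using zero_le_power2[of "norm (v - z)"] by linarith
  then show ?thesis by (rule power2_le_imp_le) simp
qed

text \<open>Projection does not increase the distance to \<open>y\<close>, so it suffices to expand
  the square for the unprojected step, whose squared length is \<open>\<alpha>\<^sup>2\<close>
  because the direction is normalised.\<close>

lemma proj_subgradient_step:
  fixes X :: "'a::euclidean_space set"
  assumes X: "closed X" "convex X" and z: "z \<in> proj_set X (x - (\<alpha> / norm \<zeta>) *\<^sub>R \<zeta>)"
    and \<zeta>: "\<zeta> \<noteq> 0" and y: "y \<in> X"
  shows "(norm (z - y))\<^sup>2 \<le> (norm (x - y))\<^sup>2 - 2 * \<alpha> * ((\<zeta> \<bullet> (x - y)) / norm \<zeta>) + \<alpha>\<^sup>2"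
proof -
  have norm_diff: "(norm (u - v))\<^sup>2 = (norm u)\<^sup>2 - 2 * (u \<bullet> v) + (norm v)\<^sup>2" for u v :: 'a
    by (simp add: power2_norm_eq_inner inner_diff_left inner_diff_right inner_commute)
  have "(norm (z - y))\<^sup>2 \<le> (norm (x - (\<alpha> / norm \<zeta>) *\<^sub>R \<zeta> - y))\<^sup>2"
    by (intro power_mono proj_set_dist_le[OF X z y]) simp
  also have "\<dots> = (norm ((x - y) - (\<alpha> / norm \<zeta>) *\<^sub>R \<zeta>))\<^sup>2" by (simp add: algebra_simps)
  also have "\<dots> = (norm (x - y))\<^sup>2 - 2 * ((\<alpha> / norm \<zeta>) * (\<zeta> \<bullet> (x - y))) + (norm ((\<alpha> / norm \<zeta>) *\<^sub>R \<zeta>))\<^sup>2"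
    by (simp add: norm_diff inner_commute)
  also have "(norm ((\<alpha> / norm \<zeta>) *\<^sub>R \<zeta>))\<^sup>2 = \<alpha>\<^sup>2" using \<zeta> by simp
  finally show ?thesis by simp
qed

section \<open>Geometric step lengths and the scalar recursion\<close>

text \<open>The increments are summable by comparison with a geometric series; the error estimate is
  the limit in \<open>n\<close> of the finite geometric sum starting at index
  \<open>k\<close>.\<close>

lemma geometric_steps_converge:
  fixes x :: "nat \<Rightarrow> 'a::banach"
  assumes q: "0 \<le> q" "q < 1" and step: "\<And>k. norm (x (Suc k) - x k) \<le> c * q ^ k"
  obtains l where "x \<longlonglongrightarrow> l" "\<And>k. norm (x k - l) \<le> c * q ^ k / (1 - q)"
proof -
  have diff: "norm (x (k + n) - x k) \<le> c * q ^ k * ((1 - q ^ n) / (1 - q))" for k n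
  proof (induction n)
    case (Suc n)
    have "norm (x (k + Suc n) - x k) \<le> norm (x (Suc (k + n)) - x (k + n)) + norm (x (k + n) - x k)"
      using norm_triangle_ineq[of "x (Suc (k + n)) - x (k + n)" "x (k + n) - x k"] by simp
    also have "\<dots> \<le> c * q ^ (k + n) + c * q ^ k * ((1 - q ^ n) / (1 - q))"
      using step Suc by (intro add_mono)
    also have "\<dots> = c * q ^ k * ((1 - q ^ Suc n) / (1 - q))"
      using q by (simp add: field_simps power_add)
    finally show ?case .
  qed simp
  have c: "0 \<le> c" using order_trans[OF norm_ge_zero step[of 0]] by simp
  have summable: "summable (\<lambda>k. x (Suc k) - x k)"
  proof (rule summable_comparison_test')
    show "summable (\<lambda>k. c * q ^ k)" using q by (intro summable_mult summable_geometric) simp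
  qed (use step in auto)
  have "(\<lambda>n. \<Sum>k<n. x (Suc k) - x k) \<longlonglongrightarrow> (\<Sum>k. x (Suc k) - x k)"
    by (rule summable_LIMSEQ[OF summable])
  then have "(\<lambda>n. (x n - x 0) + x 0) \<longlonglongrightarrow> (\<Sum>k. x (Suc k) - x k) + x 0"
    unfolding sum_lessThan_telescope by (intro tendsto_intros)
  then obtain l where l: "x \<longlonglongrightarrow> l" by auto
  show thesis
  proof
    show "x \<longlonglongrightarrow> l" by fact
    fix k
    have "(\<lambda>n. norm (x (k + n) - x k)) \<longlonglongrightarrow> norm (l - x k)"
      using LIMSEQ_ignore_initial_segment[OF l, of k]
      by (intro tendsto_intros) (simp add: add.commute)
    moreover have "norm (x (k + n) - x k) \<le> c * q ^ k / (1 - q)" for n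
    proof -
      have "c * q ^ k * ((1 - q ^ n) / (1 - q)) \<le> c * q ^ k * (1 / (1 - q))"
        using q c by (intro mult_left_mono divide_right_mono) auto
      then show ?thesis using order_trans[OF diff] by simp
    qed
    ultimately have "norm (l - x k) \<le> c * q ^ k / (1 - q)"
      by (intro LIMSEQ_le_const2) auto
    then show "norm (x k - l) \<le> c * q ^ k / (1 - q)" by (simp add: norm_minus_commute)
  qed
qed

text \<open>The right-hand side of the recursion is convex in \<open>d\<close>, so it suffices to compare the two
  endpoints \<open>d = 0\<close> and \<open>d = B\<close> of the admissible range with \<open>(q * B)\<^sup>2\<close>; the second comparison
  is \<open>\<gamma> * u\<^sup>2 - 2 * u + 1 \<le> 0\<close> for \<open>u = c * B / a\<close>.\<close>

lemma contraction_of_recursion: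
  fixes a B c d d' \<gamma> q :: real
  assumes rec: "d'\<^sup>2 \<le> d\<^sup>2 - 2 * c * a * d + a\<^sup>2"
    and d: "0 \<le> d" "d \<le> B" and \<gamma>: "0 < \<gamma>" "\<gamma> < 1"
    and a: "0 < a" "a \<le> c * B" "c * B * (1 - sqrt (1 - \<gamma>)) \<le> a"
    and c: "0 < c" "c\<^sup>2 \<le> 1 / 2" and q: "0 \<le> q" "q\<^sup>2 = 1 - \<gamma> * c\<^sup>2"
  shows "d' \<le> B * q"
proof -
  define s where "s = sqrt (1 - \<gamma>)"
  have s: "0 < s" "s < 1" "s\<^sup>2 = 1 - \<gamma>" using \<gamma> by (auto simp: s_def)
  have B: "0 < B" using a c by (meson less_le_trans zero_less_mult_pos)
  \<comment> \<open>From \<open>c\<^sup>2 \<le> 1 / 2\<close> one gets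
    \<open>q\<^sup>2 \<ge> 1 / 2 \<ge> c\<^sup>2\<close>; this settles the endpoint
    \<open>d = 0\<close>.\<close>
  have "c\<^sup>2 * \<gamma> \<le> 1 / 2 * 1" using c \<gamma> by (intro mult_mono) auto
  then have cq: "c\<^sup>2 \<le> q\<^sup>2" using q c by (simp add: mult.commute)
  have "a\<^sup>2 \<le> (c * B)\<^sup>2" using a by (intro power_mono) auto
  also have "\<dots> \<le> (q * B)\<^sup>2" using cq by (simp add: power_mult_distrib mult_right_mono)
  finally have end0: "a\<^sup>2 \<le> (q * B)\<^sup>2" .
  \<comment> \<open>The quadratic in \<open>a\<close> has roots \<open>c * B * (1 - s)\<close> and
    \<open>c * B * (1 + s)\<close>, and the hypotheses place \<open>a\<close> between them.\<close>
  have "(c * B * (1 - s) - a) * (c * B * (1 + s) - a) \<le> 0"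
    using a s c B by (intro mult_nonpos_nonneg) (auto simp: s_def algebra_simps add_increasing2)
  moreover have "(c * B * (1 - s) - a) * (c * B * (1 + s) - a)
      = (c * B)\<^sup>2 * (1 - s\<^sup>2) - 2 * (c * B) * a + a\<^sup>2" by (simp add: power2_eq_square algebra_simps)
  moreover have "(q * B)\<^sup>2 = B\<^sup>2 - \<gamma> * (c * B)\<^sup>2"
    by (simp add: q power_mult_distrib algebra_simps)
  ultimately have endB: "B\<^sup>2 - 2 * c * a * B + a\<^sup>2 \<le> (q * B)\<^sup>2" by (simp add: s algebra_simps)
  have "d'\<^sup>2 \<le> (q * B)\<^sup>2"
  proof -
    \<comment> \<open>Multiplying by \<open>B\<close> turns the interpolation weights into
      \<open>d\<close> and \<open>B - d\<close>; the dropped term \<open>B * (B - d) * d\<close> is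
      the convexity gap.\<close>
    have "B * d'\<^sup>2 \<le> B * (d\<^sup>2 - 2 * c * a * d + a\<^sup>2)" using rec B by simp
    also have "\<dots> = d * (B\<^sup>2 - 2 * c * a * B + a\<^sup>2) + (B - d) * a\<^sup>2 - B * (B - d) * d"
      by (simp add: power2_eq_square algebra_simps)
    also have "\<dots> \<le> d * (q * B)\<^sup>2 + (B - d) * (q * B)\<^sup>2 - 0"
      using d B endB end0 by (intro diff_mono add_mono mult_left_mono mult_nonneg_nonneg) auto
    also have "\<dots> = B * (q * B)\<^sup>2" by (simp add: algebra_simps)
    finally show ?thesis using B by simp
  qed
  then show ?thesis using q B by (metis mult.commute mult_nonneg_nonneg less_imp_le power2_le_imp_le)
qed

section \<open>Linear convergence of the projected subgradient iterates\<close>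

theorem theorem4p9:
  fixes h f :: "real ^ 'n \<Rightarrow> ereal"
    and X :: "(real ^ 'n) set"
    and \<rho> \<mu> \<nu> G L \<tau> \<beta> \<gamma> lam q A :: real
    and x :: "nat \<Rightarrow> real ^ 'n"
  assumes h: "legendre_kernel h"
    and X: "X \<subseteq> interior (eff_dom h)" "X \<noteq> {}" "closed X" "convex X"
    and f: "proper_ereal f"
    and \<rho>: "\<rho> > 0"
    and weakly_convex: "convex_on_ereal (interior (eff_dom h)) (\<lambda>y. f y + ereal \<rho> * h y)"
    and lipschitz: "\<And>y. y \<in> X \<Longrightarrow> finite_locally_lipschitz_at f y"
    and opt: "opt_value f X > -\<infinity>" "opt_set f X \<noteq> {}" "opt_set f X \<noteq> X"
    and sharp: "\<mu> > 0"
      "\<And>y. y \<in> X \<Longrightarrow> ereal (\<mu> * infdist y (opt_set f X)) \<le> f y - opt_value f X"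
    and growth: "0 < \<nu>" "\<nu> \<le> 1" "G > 0"
      "\<And>y. y \<in> X \<Longrightarrow> infdist y (opt_set f X) < (\<mu> / (\<rho> * G)) powr (1 / \<nu>) \<Longrightarrow>
         (INF z \<in> proj_set (opt_set f X) y. bregman h z y)
           \<le> ereal (G * infdist y (opt_set f X) powr (1 + \<nu>))"
    and L: "ereal L = (SUP \<zeta> \<in> (\<Union>y \<in> tube f X \<mu> \<rho> G \<nu> 1. frechet_subdiff f y). ereal (norm \<zeta>))"
      "L > 0"
    and \<tau>: "\<tau> = \<mu> / L"
    and \<beta>: "1 - 1 / sqrt 2 \<le> \<beta>" "\<beta> < 1"
    and \<gamma>: "0 < \<gamma>" "\<gamma> < 1"
    and lam: "0 < lam" "lam \<le> (1 - \<beta>) * \<tau> * (\<beta> * \<mu> / (\<rho> * G)) powr (1 / \<nu>)"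
    and q: "q = sqrt (1 - \<gamma> * (1 - \<beta>)\<^sup>2 * \<tau>\<^sup>2)"
    and psga: "psga_sequence f X (\<lambda>k. lam * q ^ k) x"
    and x0: "x 0 \<in> tube f X \<mu> \<rho> G \<nu> \<beta>"
      "infdist (x 0) (opt_set f X)
         \<le> lam / (\<tau> * (1 - \<beta>) - sqrt (\<tau>\<^sup>2 * (1 - \<beta>)\<^sup>2 - (1 - q\<^sup>2)))"
    and A: "A = max (lam / ((1 - \<beta>) * \<tau>)) (infdist (x 0) (opt_set f X))"
  shows "\<exists>xs. x \<longlonglongrightarrow> xs \<and>
    (\<forall>k. infdist (x k) (opt_set f X) \<le> A * q ^ k \<and>
         f (x k) - opt_value f X \<le> ereal (L * A * q ^ k) \<and>
         norm (x k - xs) \<le> lam * q ^ k / (1 - q))"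
proof -
  define S where "S = opt_set f X"
  define d where "d y = infdist y S" for y
  define F where "F y = real_of_ereal (f y)" for y
  define H where "H y = real_of_ereal (h y)" for y
  define fs where "fs = real_of_ereal (opt_value f X)"
  define U where "U = interior (eff_dom h)"
  define R where "R b = (b * \<mu> / (\<rho> * G)) powr (1 / \<nu>)" for b
  define c where "c = (1 - \<beta>) * \<tau>"
  have d_nonneg: "0 \<le> d y" for y by (simp add: d_def infdist_nonneg)
  have \<beta>0: "0 < \<beta>"
  proof -
    have "1 / sqrt 2 < (1::real)" by simp
    then show ?thesis using \<beta> by linarith
  qed
  have f_fin: "f y = ereal (F y)" if "y \<in> X" for y
    using lipschitz[OF that] unfolding finite_locally_lipschitz_at_def
    by (metis F_def centre_in_ball ereal_real)
  have S_opt: "y \<in> S \<longleftrightarrow> y \<in> X \<and> f y = opt_value f X" for y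
    by (simp add: S_def opt_set_def)
  have fs: "opt_value f X = ereal fs"
    using opt(2) f_fin unfolding opt_set_def fs_def by (smt (verit) all_not_in_conv mem_Collect_eq real_of_ereal.simps(1))
  have S: "y \<in> X" "F y = fs" if "y \<in> S" for y
    using that f_fin[of y] by (auto simp: S_opt fs)
  have h_fin: "\<bar>h y\<bar> \<noteq> \<infinity>" if "y \<in> U" for y
    using that h interior_subset[of "eff_dom h"]
    by (auto simp: U_def legendre_kernel_def proper_ereal_def eff_dom_def)
  have h_real: "h y = ereal (H y)" if "y \<in> U" for y
    using h_fin[OF that] by (simp add: H_def ereal_real)
  have h_grad: "GDERIV (\<lambda>y. real_of_ereal (h y)) y :> grad h y" if "y \<in> U" for y
    using that h grad_eq unfolding legendre_kernel_def C1_on_interior_def U_def by metis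
  have XU: "y \<in> U" if "y \<in> X" for y using that X by (auto simp: U_def)
  note conv = weakly_convex[folded U_def]
  have tube_iff: "y \<in> tube f X \<mu> \<rho> G \<nu> b \<longleftrightarrow> y \<in> X \<and> d y < R b" for y b
    by (simp add: tube_def d_def S_def R_def)
  have R_less: "R b < R b'" if "0 \<le> b" "b < b'" for b b'
    unfolding R_def using that sharp(1) \<rho> growth
    by (intro powr_less_mono2) (auto intro: divide_strict_right_mono)
  have R1: "0 < R 1" unfolding R_def using sharp(1) \<rho> growth by simp

  \<comment> \<open>An infimum over the empty set is \<infinity>, so the finite growth bound also
    yields the existence of a projection onto \<open>S\<close>. The infimum need not be attained,
    hence the slack \<open>e\<close>.\<close>
  have proj: "\<exists>z\<in>proj_set S y. H z - H y - grad h y \<bullet> (z - y) \<le> G * d y powr (1 + \<nu>) + e"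
    if y: "y \<in> X" "d y < R 1" and e: "e > 0" for y e
  proof -
    have "(INF z \<in> proj_set S y. bregman h z y) \<le> ereal (G * d y powr (1 + \<nu>))"
      using growth(4)[OF y(1)] y(2) by (simp add: S_def d_def R_def)
    also have "\<dots> < ereal (G * d y powr (1 + \<nu>) + e)" using e by simp
    finally obtain z where z: "z \<in> proj_set S y" "bregman h z y < ereal (G * d y powr (1 + \<nu>) + e)"
      by (auto simp: INF_less_iff)
    then have "z \<in> S" by (simp add: proj_set_iff)
    then have "bregman h z y = ereal (H z - H y - grad h y \<bullet> (z - y))"
      using h_real[OF XU[OF y(1)]] h_real[OF XU[OF S(1)]] by (simp add: bregman_def)
    with z show ?thesis by (intro bexI[of _ z]) auto
  qed
  have \<zeta>_bound: "norm \<zeta> \<le> L" if "y \<in> X" "d y < R 1" "\<zeta> \<in> frechet_subdiff f y" for y \<zeta>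
  proof -
    have "ereal (norm \<zeta>) \<le> ereal L" unfolding L(1)
      using that by (intro SUP_upper) (auto simp: tube_iff)
    then show ?thesis by simp
  qed
  have sharp': "\<mu> * d y \<le> F y - fs" if "y \<in> X" for y
    using sharp(2)[OF that] f_fin[OF that] by (simp add: fs d_def S_def)

  have upper: "F y - fs \<le> L * d y" if y: "y \<in> X" "d y < R 1" for y
  proof -
    \<comment> \<open>Only existence of a projection is wanted, so the slack 1 is arbitrary.\<close>
    obtain z where z: "z \<in> proj_set S y" using proj[OF y, of 1] by auto
    then have zS: "z \<in> S" by (simp add: proj_set_iff)
    \<comment> \<open>Moving towards the projection does not increase the distance to
      \<open>S\<close> beyond \<open>d y\<close>, so the bound \<open>L\<close> on subgradients is
      available on the whole segment.\<close>
    have seg: "w \<in> X" "d w < R 1" if w: "w \<in> closed_segment y z" for w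
    proof -
      show "w \<in> X" using w y(1) S(1)[OF zS] X(4) by (meson closed_segment_subset subsetD)
      have "d w \<le> dist w z" unfolding d_def by (rule infdist_le[OF zS])
      also have "\<dots> \<le> dist y z" using w by (metis dist_commute dist_in_closed_segment)
      also have "\<dots> = d y" using norm_proj_set[OF z] by (simp add: d_def dist_norm norm_minus_commute)
      finally show "d w < R 1" using y by simp
    qed
    have "F y - L * norm (y - z) \<le> F z" unfolding F_def
    proof (rule le_add_norm_of_frechet_subgradient_bound)
      fix w assume w: "w \<in> closed_segment y z"
      show "finite_locally_lipschitz_at f w" using lipschitz seg[OF w] by blast
      then have "frechet_subdiff f w \<noteq> {}"
        using XU[OF seg(1)[OF w]] h_fin h_grad
        by (intro frechet_subdiff_nonempty[OF conv]) (auto simp: U_def)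
      then show "\<exists>\<zeta>\<in>frechet_subdiff f w. norm \<zeta> \<le> L" using \<zeta>_bound seg[OF w] by blast
    qed
    then show ?thesis using S(2)[OF zS] norm_proj_set[OF z] by (simp add: d_def norm_minus_commute)
  qed

  \<comment> \<open>One point with positive distance inside the tube suffices to compare \<mu> and
    \<open>L\<close>: there \<mu> d is at most the optimality gap, which is at most \<open>L\<close>
    d.\<close>
  obtain p where p: "p \<in> X" "0 < d p" "d p < R 1"
  proof -
    obtain z where z: "z \<in> S" using opt(2) by (auto simp: S_def)
    obtain y where y: "y \<in> X" "y \<notin> S" using opt(3) S(1) by (auto simp: S_def)
    \<comment> \<open>A projection at distance 0 would be \<open>y\<close> itself, contradicting
      \<open>y \<notin> S\<close>; this takes the place of closedness of \<open>S\<close>.\<close>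
    have "d y \<noteq> 0"
    proof
      assume "d y = 0"
      then have "d y < R 1" using R1 by simp
      then obtain w where "w \<in> proj_set S y" using proj[OF y(1) _ zero_less_one] by auto
      then show False using norm_proj_set[of w S y] \<open>d y = 0\<close> y(2) by (auto simp: d_def proj_set_iff)
    qed
    then have dy: "0 < d y" using d_nonneg[of y] by simp
    define m where "m = min (d y) (R 1) / 2"
    have m: "0 < m" "m < d y" "m < R 1" using dy R1 by (auto simp: m_def)
    \<comment> \<open>The distance to \<open>S\<close> is continuous and vanishes at
      \<open>z\<close>, so it takes the value \<open>m\<close> on the segment to
      \<open>y\<close>.\<close>
    have "\<exists>t\<ge>0. t \<le> 1 \<and> d (z + t *\<^sub>R (y - z)) = m"
    proof (rule IVT')
      show "d (z + 0 *\<^sub>R (y - z)) \<le> m" using z m by (simp add: d_def)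
      show "m \<le> d (z + 1 *\<^sub>R (y - z))" using m by simp
      show "continuous_on {0..1} (\<lambda>t. d (z + t *\<^sub>R (y - z)))"
        unfolding d_def by (intro continuous_intros)
    qed simp
    then obtain t where t: "0 \<le> t" "t \<le> 1" "d (z + t *\<^sub>R (y - z)) = m" by blast
    have "z + t *\<^sub>R (y - z) = (1 - t) *\<^sub>R z + t *\<^sub>R y" by (simp add: algebra_simps)
    also have "\<dots> \<in> X" using t X(4) y(1) S(1)[OF z] by (intro convexD) auto
    finally show thesis using that t m by metis
  qed
  have "\<mu> * d p \<le> L * d p" using sharp'[OF p(1)] upper[OF p(1,3)] by simp
  then have "\<mu> \<le> L" using p(2) by simp
  then have \<tau>1: "0 < \<tau>" "\<tau> \<le> 1" using \<tau> sharp(1) L(2) by auto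
  have c: "0 < c" "c\<^sup>2 \<le> 1 / 2"
  proof -
    show "0 < c" using \<tau>1 \<beta> by (simp add: c_def)
    \<comment> \<open>The lower bound on \<beta> enters together with \<tau> at most 1.\<close>
    have "c \<le> (1 / sqrt 2) * 1" unfolding c_def using \<tau>1 \<beta> by (intro mult_mono) auto
    then have "c\<^sup>2 \<le> (1 / sqrt 2)\<^sup>2" using \<open>0 < c\<close> by (intro power_mono) auto
    then show "c\<^sup>2 \<le> 1 / 2" by (simp add: power_divide)
  qed
  have q_c: "q = sqrt (1 - \<gamma> * c\<^sup>2)" using q by (simp add: c_def power_mult_distrib)
  have "\<gamma> * c\<^sup>2 \<le> 1 * (1 / 2)" using \<gamma> c by (intro mult_mono) auto
  moreover have "0 < \<gamma> * c\<^sup>2" using \<gamma> c by simp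
  ultimately have q1: "0 < q" "q < 1" "q\<^sup>2 = 1 - \<gamma> * c\<^sup>2" by (auto simp: q_c)

  \<comment> \<open>One step of the algorithm inside the tube\<close>
  \<comment> \<open>Raising \<open>d y \<le> R \<beta>\<close> to the power \<nu> makes the
    superlinear growth bound linear with constant \<beta> \<mu>, a fraction of the sharpness. The
    inequality is not strict because only \<open>A \<le> R \<beta>\<close> will be known;
    \<open>R \<beta> < R 1\<close> restores strictness where \<open>L\<close> is used.\<close>
  have growth_le: "\<rho> * (G * d y powr (1 + \<nu>)) \<le> \<beta> * \<mu> * d y" if "d y \<le> R \<beta>" for y
  proof (cases "d y = 0")
    case False
    then have dy: "0 < d y" using d_nonneg[of y] by simp
    have "d y powr \<nu> \<le> R \<beta> powr \<nu>" using that dy growth by (intro powr_mono2) auto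
    also have "\<dots> = \<beta> * \<mu> / (\<rho> * G)"
      using growth \<beta>0 sharp(1) \<rho> by (simp add: R_def powr_powr)
    finally have "\<rho> * G * d y powr \<nu> \<le> \<beta> * \<mu>" using \<rho> growth by (simp add: field_simps)
    then have "\<rho> * G * d y powr \<nu> * d y \<le> \<beta> * \<mu> * d y" using dy by (intro mult_right_mono) auto
    then show ?thesis using dy by (simp add: powr_add mult_ac)
  qed simp

  have angle: "\<exists>z\<in>proj_set S y. (1 - \<beta>) * \<mu> * d y - \<rho> * e \<le> \<zeta> \<bullet> (y - z)"
    if y: "y \<in> X" "d y \<le> R \<beta>" and \<zeta>: "\<zeta> \<in> frechet_subdiff f y" and e: "e > 0" for y \<zeta> e
  proof -
    have y1: "d y < R 1" using R_less[of \<beta> 1] \<beta> \<beta>0 y(2) by simp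
    obtain z where z: "z \<in> proj_set S y"
        "H z - H y - grad h y \<bullet> (z - y) \<le> G * d y powr (1 + \<nu>) + e"
      using proj[OF y(1) y1 e] by blast
    have zS: "z \<in> S" using z by (simp add: proj_set_iff)
    have "F y + \<zeta> \<bullet> (z - y) - \<rho> * (H z - H y - grad h y \<bullet> (z - y)) \<le> F z"
      unfolding F_def H_def
      using XU y(1) S(1)[OF zS] h_fin h_grad \<rho> f_fin \<zeta>
      by (intro frechet_subgradient_bregman_le[OF conv]) auto
    moreover have "\<rho> * (H z - H y - grad h y \<bullet> (z - y)) \<le> \<rho> * (G * d y powr (1 + \<nu>)) + \<rho> * e"
      using mult_left_mono[OF z(2), of \<rho>] \<rho> by (simp add: distrib_left)
    ultimately have "(1 - \<beta>) * \<mu> * d y - \<rho> * e \<le> \<zeta> \<bullet> (y - z)"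
      using sharp'[OF y(1)] growth_le[OF y(2)] S(2)[OF zS]
      by (simp add: inner_diff_right left_diff_distrib)
    then show ?thesis using z(1) by blast
  qed

  have descent: "(d y')\<^sup>2 \<le> (d y)\<^sup>2 - 2 * c * a * d y + a\<^sup>2"
    if y: "y \<in> X" "d y \<le> R \<beta>" and \<zeta>: "\<zeta> \<in> frechet_subdiff f y" and a: "0 < a"
      and step: "if \<zeta> = 0 then y' = y else y' \<in> proj_set X (y - (a / norm \<zeta>) *\<^sub>R \<zeta>)" for y y' \<zeta> a
  proof (cases "\<zeta> = 0")
    case True
    \<comment> \<open>A zero subgradient within this range forces \<open>d y = 0\<close>; the
      iterate then stays put and the right-hand side is \<open>a\<^sup>2\<close>.\<close>
    have "(1 - \<beta>) * \<mu> * d y \<le> 0"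
    proof (rule le_of_le_add_small_mult)
      fix e :: real assume "e > 0"
      then show "(1 - \<beta>) * \<mu> * d y \<le> 0 + e * \<rho>" using angle[OF y \<zeta>, of e] True by (auto simp: mult.commute)
    qed
    then have "d y = 0" using \<beta> sharp(1) d_nonneg[of y] by (simp add: mult_le_0_iff)
    then show ?thesis using step True by simp
  next
    case False
    have n: "0 < norm \<zeta>" "norm \<zeta> \<le> L"
      using False \<zeta>_bound[OF y(1) _ \<zeta>] R_less[of \<beta> 1] \<beta> \<beta>0 y(2) by auto
    have y': "y' \<in> proj_set X (y - (a / norm \<zeta>) *\<^sub>R \<zeta>)" using step False by simp
    show ?thesis
    proof (rule le_of_le_add_small_mult)
      fix e :: real assume e: "e > 0"
      obtain z where z: "z \<in> proj_set S y" "(1 - \<beta>) * \<mu> * d y - \<rho> * e \<le> \<zeta> \<bullet> (y - z)"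
        using angle[OF y \<zeta> e] by blast
      have zS: "z \<in> S" using z by (simp add: proj_set_iff)
      have "d y' \<le> norm (y' - z)" using infdist_le[OF zS, of y'] by (simp add: d_def dist_norm)
      then have "(d y')\<^sup>2 \<le> (norm (y' - z))\<^sup>2" using d_nonneg by (intro power_mono) auto
      also have "\<dots> \<le> (norm (y - z))\<^sup>2 - 2 * a * ((\<zeta> \<bullet> (y - z)) / norm \<zeta>) + a\<^sup>2"
        using proj_subgradient_step[OF X(3,4) y' False S(1)[OF zS]] .
      also have "norm (y - z) = d y"
        using norm_proj_set[OF z(1)] by (simp add: d_def norm_minus_commute)
      finally have *: "(d y')\<^sup>2 \<le> (d y)\<^sup>2 - 2 * a * ((\<zeta> \<bullet> (y - z)) / norm \<zeta>) + a\<^sup>2" .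
      have "c * d y - \<rho> * e / norm \<zeta> = (1 - \<beta>) * \<mu> * d y / L - \<rho> * e / norm \<zeta>"
        by (simp add: c_def \<tau>)
      \<comment> \<open>Replacing \<open>L\<close> by the smaller \<open>norm \<zeta>\<close>
        increases a nonnegative quotient; \<tau> = \<mu> / \<open>L\<close> is the worst case over
        the tube.\<close>
      also have "\<dots> \<le> (1 - \<beta>) * \<mu> * d y / norm \<zeta> - \<rho> * e / norm \<zeta>"
        using n L(2) \<beta> sharp(1) d_nonneg[of y] by (intro diff_right_mono divide_left_mono) auto
      also have "\<dots> \<le> (\<zeta> \<bullet> (y - z)) / norm \<zeta>"
        using z(2) n by (simp add: diff_divide_distrib[symmetric] divide_right_mono)
      finally have "2 * a * (c * d y - \<rho> * e / norm \<zeta>) \<le> 2 * a * ((\<zeta> \<bullet> (y - z)) / norm \<zeta>)"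
        using a by (intro mult_left_mono) auto
      with * show "(d y')\<^sup>2 \<le> (d y)\<^sup>2 - 2 * c * a * d y + a\<^sup>2 + e * (2 * a * \<rho> / norm \<zeta>)"
        by (simp add: algebra_simps)
    qed
  qed

  \<comment> \<open>Constants for the initial point and induction along the iterates\<close>
  define s where "s = sqrt (1 - \<gamma>)"
  have s: "0 < s" "s < 1" using \<gamma> by (auto simp: s_def)
  \<comment> \<open>The radicand in the condition on \<open>x 0\<close> is
    \<open>c\<^sup>2 * (1 - \<gamma>)\<close>, so the condition says that \<open>lam\<close> is at
    least \<open>c * (1 - s)\<close> times the initial distance, the smaller root in the scalar
    recursion.\<close>
  have "\<tau>\<^sup>2 * (1 - \<beta>)\<^sup>2 = c\<^sup>2" by (simp add: c_def power_mult_distrib mult.commute)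
  then have "\<tau>\<^sup>2 * (1 - \<beta>)\<^sup>2 - (1 - q\<^sup>2) = c\<^sup>2 * (1 - \<gamma>)"
    using q1(3) by (simp add: algebra_simps)
  then have root: "sqrt (\<tau>\<^sup>2 * (1 - \<beta>)\<^sup>2 - (1 - q\<^sup>2)) = c * s"
    using c by (simp only: real_sqrt_mult s_def real_sqrt_abs)
  have "\<tau> * (1 - \<beta>) - c * s = c * (1 - s)" by (simp add: c_def algebra_simps)
  then have d0: "d (x 0) \<le> lam / (c * (1 - s))"
    using x0(2) unfolding root d_def S_def by simp
  have A': "A = max (lam / c) (d (x 0))" using A by (simp add: c_def d_def S_def)
  have A_ge: "lam \<le> c * A" "d (x 0) \<le> A"
    using c by (auto simp: A' max_def field_simps)
  have "lam / c \<le> lam / (c * (1 - s))"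
    using c s lam by (intro divide_left_mono) auto
  then have "A \<le> lam / (c * (1 - s))" using d0 by (simp add: A')
  then have A_le: "c * A * (1 - s) \<le> lam" using c s by (simp add: field_simps)
  have x0X: "x 0 \<in> X" "d (x 0) < R \<beta>" using x0(1) by (auto simp: tube_iff)
  have "lam / c \<le> R \<beta>" using lam(2) c by (simp add: c_def R_def field_simps)
  then have A_R: "A \<le> R \<beta>" using x0X(2) by (simp add: A')
  have A_pos: "0 \<le> A" using A_ge(2) d_nonneg order_trans by blast

  obtain \<zeta> where \<zeta>: "\<And>k. \<zeta> k \<in> frechet_subdiff f (x k)"
    and step: "\<And>k. if \<zeta> k = 0 then x (Suc k) = x k
        else x (Suc k) \<in> proj_set X (x k - (lam * q ^ k / norm (\<zeta> k)) *\<^sub>R \<zeta> k)"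
    using psga unfolding psga_sequence_def by blast
  have xX: "x k \<in> X" for k
  proof (induction k)
    case (Suc k) then show ?case using step[of k] by (auto simp: proj_set_iff split: if_splits)
  qed (rule x0X)
  have Aq_R: "A * q ^ k \<le> R \<beta>" for k
    using A_R A_pos q1 mult_left_mono[OF power_le_one[of q k] A_pos] by simp
  have d_le: "d (x k) \<le> A * q ^ k" for k
  proof (induction k)
    case 0 then show ?case using A_ge by simp
  next
    case (Suc k)
    have qk: "0 < q ^ k" using q1 by simp
    have "d (x (Suc k)) \<le> A * q ^ k * q"
    \<comment> \<open>Here \<open>B\<close> is \<open>A * q ^ k\<close>. Step size and bound both
      scale with \<open>q ^ k\<close>, so the conditions relating them for \<open>k = 0\<close>
      persist, and \<open>A * q ^ k \<le> R \<beta>\<close> keeps the descent estimate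
      applicable.\<close>
    proof (rule contraction_of_recursion[where a = "lam * q ^ k" and d = "d (x k)" and c = c and \<gamma> = \<gamma>])
      show "(d (x (Suc k)))\<^sup>2 \<le> (d (x k))\<^sup>2 - 2 * c * (lam * q ^ k) * d (x k) + (lam * q ^ k)\<^sup>2"
        using order_trans[OF Suc Aq_R] lam(1) qk by (intro descent[OF xX _ \<zeta> _ step]) auto
      show "lam * q ^ k \<le> c * (A * q ^ k)"
        using mult_right_mono[OF A_ge(1), of "q ^ k"] qk by (simp add: mult.assoc)
      show "c * (A * q ^ k) * (1 - sqrt (1 - \<gamma>)) \<le> lam * q ^ k"
        using mult_right_mono[OF A_le, of "q ^ k"] qk by (simp add: s_def mult_ac)
    qed (use Suc d_nonneg \<gamma> lam c q1 qk in auto)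
    then show ?case by (simp add: mult_ac)
  qed
  have f_le: "f (x k) - opt_value f X \<le> ereal (L * A * q ^ k)" for k
  proof -
    have "d (x k) < R 1" using d_le[of k] Aq_R[of k] R_less[of \<beta> 1] \<beta> \<beta>0 by linarith
    then have "F (x k) - fs \<le> L * d (x k)" by (rule upper[OF xX])
    also have "\<dots> \<le> L * (A * q ^ k)" using d_le L(2) by (intro mult_left_mono) auto
    finally show ?thesis using f_fin[OF xX] by (simp add: fs mult.assoc)
  qed
  have "norm (x (Suc k) - x k) \<le> lam * q ^ k" for k
  proof (cases "\<zeta> k = 0")
    case True then show ?thesis using step[of k] lam q1 by simp
  next
    case False
    \<comment> \<open>As \<open>x k\<close> lies in \<open>X\<close>, the projection brings the
      trial point no farther from \<open>x k\<close>, so the move is at most the step size.\<close>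
    then have "norm (x (Suc k) - x k) \<le> norm (x k - (lam * q ^ k / norm (\<zeta> k)) *\<^sub>R \<zeta> k - x k)"
      using step[of k] by (intro proj_set_dist_le[OF X(3,4) _ xX]) simp
    then show ?thesis using False lam q1 by simp
  qed
  from geometric_steps_converge[OF _ q1(2) this] q1(1)
  obtain xs where "x \<longlonglongrightarrow> xs" "\<And>k. norm (x k - xs) \<le> lam * q ^ k / (1 - q)"
    by (metis less_imp_le)
  then show ?thesis using d_le f_le by (auto simp: d_def S_def)
qed

end
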